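(* There are infinitely many matroids $M$ without loops and coloops for which $$T_M(2,0)\,T_M(0,2)<T_M(1,1)^2.$$
   Context: For a finite matroid $M$ on ground set $E$ with rank function $r$, the Tutte polynomial is $T_M(x,y)=\sum_{S\subseteq E}(x-1)^{r(E)-r(S)}(y-1)^{|S|-r(S)}$. A loop is an element $e$ with $r(\{e\})=0$; a coloop is an element contained in every basis of $M$. *)

theory Defs
  imports Main
begin

record 'a matroid =
  ground :: "'a set"
  indep_sets :: "'a set set"

definition matroid :: "'a matroid \<Rightarrow> bool" where
  "matroid M \<longleftrightarrow>
     finite (ground M) \<and>
     indep_sets M \<subseteq> Pow (ground M) \<and>
     {} \<in> indep_sets M \<and>
     (\<forall>X Y. X \<in> indep_sets M \<and> Y \<subseteq> X \<longrightarrow> Y \<in> indep_sets M) \<and>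
     (\<forall>X Y. X \<in> indep_sets M \<and> Y \<in> indep_sets M \<and> card X < card Y \<longrightarrow>
        (\<exists>e \<in> Y - X. insert e X \<in> indep_sets M))"

definition mrank :: "'a matroid \<Rightarrow> 'a set \<Rightarrow> nat" where
  "mrank M S = Max (card ` {X \<in> indep_sets M. X \<subseteq> S})"

definition basis :: "'a matroid \<Rightarrow> 'a set \<Rightarrow> bool" where
  "basis M B \<longleftrightarrow> B \<in> indep_sets M \<and> (\<forall>X \<in> indep_sets M. B \<subseteq> X \<longrightarrow> X = B)"

definition is_loop :: "'a matroid \<Rightarrow> 'a \<Rightarrow> bool" where
  "is_loop M e \<longleftrightarrow> e \<in> ground M \<and> mrank M {e} = 0"

definition is_coloop :: "'a matroid \<Rightarrow> 'a \<Rightarrow> bool" where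
  "is_coloop M e \<longleftrightarrow> e \<in> ground M \<and> (\<forall>B. basis M B \<longrightarrow> e \<in> B)"

text \<open>The Tutte polynomial as a polynomial function over an arbitrary commutative ring. For a
  matroid both exponents are nonnegative, so truncated subtraction is harmless; \<^term>\<open>0 ^ 0 = 1\<close>
  gives the usual convention at \<^term>\<open>x = 1\<close> and \<^term>\<open>y = 1\<close>.\<close>

definition tutte :: "'a matroid \<Rightarrow> 'r \<Rightarrow> 'r \<Rightarrow> 'r::comm_ring_1" where
  "tutte M x y =
     (\<Sum>S \<in> Pow (ground M).
        (x - 1) ^ (mrank M (ground M) - mrank M S) * (y - 1) ^ (card S - mrank M S))"

definition matroid_iso :: "('a matroid \<times> 'a matroid) set" where
  "matroid_iso = {(M, N). matroid M \<and> matroid N \<and>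
     (\<exists>f. bij_betw f (ground M) (ground N) \<and>
        (\<forall>X \<subseteq> ground M. X \<in> indep_sets M \<longleftrightarrow> f ` X \<in> indep_sets N))}"

lemma equiv_matroid_iso: "equiv {M :: 'a matroid. matroid M} matroid_iso"
proof (rule equivI)
  show "matroid_iso \<subseteq> {M. matroid M} \<times> {M. matroid M}"
    by (auto simp: matroid_iso_def)
  show "refl_on {M. matroid M} matroid_iso"
    by (auto simp: refl_on_def matroid_iso_def intro!: exI[of _ id])
  show "sym (matroid_iso :: ('a matroid \<times> 'a matroid) set)"
  proof (rule symI)
    fix M N :: "'a matroid"
    assume "(M, N) \<in> matroid_iso"
    then obtain f where m: "matroid M" "matroid N" and f: "bij_betw f (ground M) (ground N)"
      and i: "\<And>X. X \<subseteq> ground M \<Longrightarrow> X \<in> indep_sets M \<longleftrightarrow> f ` X \<in> indep_sets N"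
      by (auto simp: matroid_iso_def)
    let ?g = "the_inv_into (ground M) f"
    have g: "bij_betw ?g (ground N) (ground M)"
      using f by (rule bij_betw_the_inv_into)
    have "Y \<in> indep_sets N \<longleftrightarrow> ?g ` Y \<in> indep_sets M" if Y: "Y \<subseteq> ground N" for Y
    proof -
      have "?g ` Y \<subseteq> ground M" using g Y by (auto simp: bij_betw_def)
      moreover have "f ` ?g ` Y = Y"
        using f Y by (force simp: image_image f_the_inv_into_f_bij_betw subset_iff)
      ultimately show ?thesis using i[of "?g ` Y"] by simp
    qed
    with m g show "(N, M) \<in> matroid_iso" by (auto simp: matroid_iso_def)
  qed
  show "trans (matroid_iso :: ('a matroid \<times> 'a matroid) set)"
  proof (rule transI)
    fix M N P :: "'a matroid"
    assume "(M, N) \<in> matroid_iso" "(N, P) \<in> matroid_iso"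
    then obtain f g where m: "matroid M" "matroid P"
      and f: "bij_betw f (ground M) (ground N)" and g: "bij_betw g (ground N) (ground P)"
      and i: "\<And>X. X \<subseteq> ground M \<Longrightarrow> X \<in> indep_sets M \<longleftrightarrow> f ` X \<in> indep_sets N"
      and j: "\<And>X. X \<subseteq> ground N \<Longrightarrow> X \<in> indep_sets N \<longleftrightarrow> g ` X \<in> indep_sets P"
      by (auto simp: matroid_iso_def)
    have "X \<in> indep_sets M \<longleftrightarrow> (g \<circ> f) ` X \<in> indep_sets P" if X: "X \<subseteq> ground M" for X
    proof -
      have "f ` X \<subseteq> ground N" using f X by (auto simp: bij_betw_def)
      then show ?thesis using i[OF X] j[of "f ` X"] by (simp add: image_comp)
    qed
    with m bij_betw_trans[OF f g] show "(M, P) \<in> matroid_iso"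
      by (auto simp: matroid_iso_def)
  qed
qed

end

theory Submission
  imports Defs
begin

text \<open>The matroids are the 2-thickenings of the uniform matroids of rank \<open>2m\<close> on \<open>3m\<close> elements,
  that is, every element is doubled by a parallel one. With \<open>n = 3m\<close>, \<open>T(0,2)\<close> is a signed sum over
  all subsets, so it is at most \<open>4\<^sup>n\<close>; in \<open>T(2,0)\<close> the signs cancel within each parallel class, which
  leaves one term \<open>\<plusminus>1\<close> per subset of the \<open>n\<close> classes, so it is at most \<open>2\<^sup>n\<close>. Hence the product is at
  most \<open>8\<^sup>n\<close>, whereas \<open>T(1,1)\<close> counts the \<open>4\<^sup>m (3m choose m)\<close> bases and its square grows like
  \<open>9\<^sup>n / n\<close>.\<close>

section \<open>Truncated partition matroids\<close>

text \<open>The fibres of \<open>f\<close> serve as blocks, so transversality becomes injectivity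
  and numbers of classes become cardinalities of images.\<close>

definition truncated_partition :: "'a set \<Rightarrow> ('a \<Rightarrow> 'b) \<Rightarrow> nat \<Rightarrow> 'a matroid" where
  "truncated_partition E f r =
     \<lparr>ground = E, indep_sets = {X. X \<subseteq> E \<and> inj_on f X \<and> card X \<le> r}\<rparr>"

lemma ground_truncated_partition [simp]: "ground (truncated_partition E f r) = E"
  by (simp add: truncated_partition_def)

lemma indep_truncated_partition_iff:
  "X \<in> indep_sets (truncated_partition E f r) \<longleftrightarrow> X \<subseteq> E \<and> inj_on f X \<and> card X \<le> r"
  by (simp add: truncated_partition_def)

text \<open>An independent set meets as many classes as it has elements, so the larger of two meets
  a class that the smaller misses and can supply an element from it.\<close>

lemma matroid_truncated_partition:
  assumes "finite E"
  shows "matroid (truncated_partition E f r)"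
proof -
  have augment: "\<exists>e \<in> Y - X. insert e X \<in> indep_sets (truncated_partition E f r)"
    if X: "X \<in> indep_sets (truncated_partition E f r)"
      and Y: "Y \<in> indep_sets (truncated_partition E f r)" and less: "card X < card Y" for X Y
  proof -
    have fin: "finite X" "finite Y"
      using X Y assms by (auto simp: indep_truncated_partition_iff intro: finite_subset)
    have "card (f ` X) < card (f ` Y)"
      using X Y less by (simp add: indep_truncated_partition_iff card_image)
    then have "\<not> f ` Y \<subseteq> f ` X"
      using fin by (meson card_mono finite_imageI not_le)
    then obtain e where "e \<in> Y" "f e \<notin> f ` X" by auto
    moreover from this have "e \<notin> X" by auto
    ultimately show ?thesis
      using X Y less fin by (intro bexI[of _ e]) (auto simp: indep_truncated_partition_iff)
  qed
  have down: "Y \<in> indep_sets (truncated_partition E f r)"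
    if X: "X \<in> indep_sets (truncated_partition E f r)" and Y: "Y \<subseteq> X" for X Y
  proof -
    have "finite X"
      using X assms by (auto simp: indep_truncated_partition_iff intro: finite_subset)
    from card_mono[OF this Y] X Y show ?thesis
      by (auto simp: indep_truncated_partition_iff intro: inj_on_subset)
  qed
  have "indep_sets (truncated_partition E f r) \<subseteq> Pow E"
    and "{} \<in> indep_sets (truncated_partition E f r)"
    by (auto simp: indep_truncated_partition_iff)
  then show ?thesis
    using assms augment down unfolding matroid_def by (simp; blast)
qed

text \<open>An independent subset has at most one element in each class met by \<open>S\<close>;
  representatives of sufficiently many of these classes attain the bound.\<close>

lemma mrank_truncated_partition:
  assumes "finite E" "S \<subseteq> E"
  shows "mrank (truncated_partition E f r) S = min r (card (f ` S))"
  unfolding mrank_def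
proof (rule Max_eqI)
  let ?I = "{X \<in> indep_sets (truncated_partition E f r). X \<subseteq> S}"
  have finS: "finite S" using assms by (rule rev_finite_subset)
  have "?I \<subseteq> Pow S" by auto
  with finS show "finite (card ` ?I)"
    by (meson finite_Pow_iff finite_imageI finite_subset)
  show "k \<le> min r (card (f ` S))" if k: "k \<in> card ` ?I" for k
  proof -
    from k obtain X where X: "X \<subseteq> S" "inj_on f X" "card X \<le> r" "k = card X"
      by (auto simp: indep_truncated_partition_iff)
    have "card (f ` X) \<le> card (f ` S)"
      using X finS by (intro card_mono) auto
    with X show ?thesis by (simp add: card_image)
  qed
  obtain A where A: "A \<subseteq> f ` S" "card A = min r (card (f ` S))"
    by (meson min.cobounded2 obtain_subset_with_card_n)
  then obtain X where X: "X \<subseteq> S" "inj_on f X" "A = f ` X"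
    by (auto simp: subset_image_inj)
  with A have "card X = min r (card (f ` S))" by (simp add: card_image)
  moreover from this have "X \<in> ?I"
    using X assms by (auto simp: indep_truncated_partition_iff)
  ultimately show "min r (card (f ` S)) \<in> card ` ?I" by force
qed

lemma no_loop_truncated_partition:
  assumes "finite E" "r > 0"
  shows "\<not> is_loop (truncated_partition E f r) e"
  using assms by (auto simp: is_loop_def mrank_truncated_partition)

lemma basis_truncated_partition:
  assumes "finite E" "B \<subseteq> E" "inj_on f B" "card B = r"
  shows "basis (truncated_partition E f r) B"
  unfolding basis_def
proof (intro conjI ballI impI)
  show "B \<in> indep_sets (truncated_partition E f r)"
    using assms by (simp add: indep_truncated_partition_iff)
  fix X assume "X \<in> indep_sets (truncated_partition E f r)" "B \<subseteq> X"
  then show "X = B"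
    using assms card_seteq[of X B]
    by (auto simp: indep_truncated_partition_iff finite_subset)
qed

lemma no_coloop_truncated_partition:
  assumes "finite E" "r < card (f ` E)"
  shows "\<not> is_coloop (truncated_partition E f r) e"
proof
  assume e: "is_coloop (truncated_partition E f r) e"
  \<comment> \<open>At least \<open>r\<close> classes remain without that of \<open>e\<close>;
    representatives of \<open>r\<close> of them form a basis avoiding \<open>e\<close>.\<close>
  have "r \<le> card (f ` E - {f e})"
    using assms by (auto simp: card_Diff_singleton_if)
  then obtain A where A: "A \<subseteq> f ` E - {f e}" "card A = r"
    by (meson obtain_subset_with_card_n)
  then obtain B where B: "B \<subseteq> E" "inj_on f B" "A = f ` B"
    by (metis Diff_subset subset_image_inj subset_trans)
  then have "basis (truncated_partition E f r) B"
    using A assms by (intro basis_truncated_partition) (auto simp: card_image)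
  with e A B show False by (auto simp: is_coloop_def)
qed

lemma card_ground_eq_of_iso:
  assumes "(M, N) \<in> matroid_iso"
  shows "card (ground M) = card (ground N)"
  using assms by (auto simp: matroid_iso_def dest: bij_betw_same_card)

section \<open>Values of the Tutte polynomial\<close>

text \<open>At \<open>(0, 2)\<close> every summand is \<open>1\<close> or \<open>-1\<close>, so the
  number of subsets is a bound.\<close>

lemma tutte_0_2_le:
  assumes "finite (ground M)"
  shows "\<bar>tutte M (0::int) 2\<bar> \<le> 2 ^ card (ground M)"
proof -
  have "\<bar>tutte M (0::int) 2\<bar> \<le> (\<Sum>S \<in> Pow (ground M). 1)"
    unfolding tutte_def by (rule order_trans[OF sum_abs]) (simp add: power_abs)
  also have "\<dots> = 2 ^ card (ground M)" using assms by (simp add: card_Pow)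
  finally show ?thesis .
qed

lemma sum_Pow_insert:
  fixes g :: "'a set \<Rightarrow> 'b::comm_monoid_add"
  assumes "finite A" "x \<notin> A"
  shows "(\<Sum>S \<in> Pow (insert x A). g S) = (\<Sum>S \<in> Pow A. g S + g (insert x S))"
proof -
  have "inj_on (insert x) (Pow A)"
    using assms by (auto simp: inj_on_def)
  moreover have "Pow A \<inter> insert x ` Pow A = {}"
    using assms by auto
  ultimately show ?thesis
    using assms by (simp add: Pow_insert sum.union_disjoint sum.reindex sum.distrib)
qed

text \<open>In a class \<open>{e, e'}\<close> the three nonempty choices have signs \<open>-1, -1, +1\<close>.\<close>

lemma signed_sum_over_pairs:
  fixes g :: "nat set \<Rightarrow> int"
  shows "(\<Sum>S \<in> Pow {..<2 * n}. (-1) ^ card S * g ((\<lambda>k. k div 2) ` S)) =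
         (\<Sum>A \<in> Pow {..<n}. (-1) ^ card A * g A)"
proof (induction n arbitrary: g)
  case 0
  then show ?case by simp
next
  case (Suc n)
  let ?d = "\<lambda>k::nat. k div 2"
  \<comment> \<open>Summing over the choices in the last pair \<open>2 * n\<close>,
    \<open>2 * n + 1\<close> leaves \<open>?h\<close>: the empty choice gives \<open>g A\<close>,
    the other three together \<open>- g (insert n A)\<close>. The induction hypothesis is used for
    \<open>?h\<close>, hence the arbitrary \<open>g\<close>.\<close>
  let ?h = "\<lambda>A. g A - g (insert n A)"
  have "{..<2 * Suc n} = insert (Suc (2 * n)) (insert (2 * n) {..<2 * n})" by auto
  then have "(\<Sum>S \<in> Pow {..<2 * Suc n}. (-1) ^ card S * g (?d ` S)) =
     (\<Sum>S \<in> Pow {..<2 * n}.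
        (-1) ^ card S * g (?d ` S)
        + (-1) ^ card (insert (Suc (2 * n)) S) * g (?d ` insert (Suc (2 * n)) S)
        + ((-1) ^ card (insert (2 * n) S) * g (?d ` insert (2 * n) S)
        + (-1) ^ card (insert (Suc (2 * n)) (insert (2 * n) S))
            * g (?d ` insert (Suc (2 * n)) (insert (2 * n) S))))"
    by (simp only:) (subst sum_Pow_insert; simp add: sum_Pow_insert sum.distrib)+
  also have "\<dots> = (\<Sum>S \<in> Pow {..<2 * n}. (-1) ^ card S * ?h (?d ` S))"
  proof (rule sum.cong[OF refl])
    fix S assume "S \<in> Pow {..<2 * n}"
    then have S: "finite S" "2 * n \<notin> S" "Suc (2 * n) \<notin> S"
      by (auto intro: finite_subset)
    then show "(-1) ^ card S * g (?d ` S)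
        + (-1) ^ card (insert (Suc (2 * n)) S) * g (?d ` insert (Suc (2 * n)) S)
        + ((-1) ^ card (insert (2 * n) S) * g (?d ` insert (2 * n) S)
        + (-1) ^ card (insert (Suc (2 * n)) (insert (2 * n) S))
            * g (?d ` insert (Suc (2 * n)) (insert (2 * n) S))) =
      (-1) ^ card S * ?h (?d ` S)"
      by (simp add: algebra_simps)
  qed
  also have "\<dots> = (\<Sum>A \<in> Pow {..<n}. (-1) ^ card A * ?h A)" by (rule Suc.IH)
  also have "\<dots> = (\<Sum>A \<in> Pow {..<n}. (-1) ^ card A * g A + (-1) ^ card (insert n A) * g (insert n A))"
  proof (rule sum.cong[OF refl])
    fix A assume "A \<in> Pow {..<n}"
    then have "finite A" "n \<notin> A" by (auto intro: finite_subset)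
    then show "(-1) ^ card A * ?h A =
        (-1) ^ card A * g A + (-1) ^ card (insert n A) * g (insert n A)"
      by (simp add: algebra_simps)
  qed
  also have "\<dots> = (\<Sum>A \<in> Pow {..<Suc n}. (-1) ^ card A * g A)"
    by (simp add: lessThan_Suc sum_Pow_insert)
  finally show ?case .
qed

text \<open>Class \<open>i\<close> is the pair \<open>2 * i\<close>, \<open>2 * i + 1\<close>, so
  this is the uniform matroid of rank \<open>r\<close> on \<open>n\<close> elements with each
  element doubled (for \<open>r \<le> n\<close>).\<close>

definition thick_uniform :: "nat \<Rightarrow> nat \<Rightarrow> nat matroid" where
  "thick_uniform n r = truncated_partition {..<2 * n} (\<lambda>k. k div 2) r"

lemma ground_thick_uniform [simp]: "ground (thick_uniform n r) = {..<2 * n}"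
  by (simp add: thick_uniform_def)

lemma mrank_thick_uniform:
  "S \<subseteq> {..<2 * n} \<Longrightarrow> mrank (thick_uniform n r) S = min r (card ((\<lambda>k. k div 2) ` S))"
  unfolding thick_uniform_def by (rule mrank_truncated_partition) auto

lemma image_div_2_lessThan: "(\<lambda>k. k div 2) ` {..<2 * n} = {..<n::nat}"
proof
  show "{..<n} \<subseteq> (\<lambda>k. k div 2) ` {..<2 * n}"
  proof
    fix i assume "i \<in> {..<n}"
    then show "i \<in> (\<lambda>k. k div 2) ` {..<2 * n}"
      by (intro image_eqI[of _ _ "2 * i"]) auto
  qed
qed auto

lemma tutte_thick_uniform_2_0_le: "\<bar>tutte (thick_uniform n r) (2::int) 0\<bar> \<le> 2 ^ n"
proof -
  have "tutte (thick_uniform n r) (2::int) 0 =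
      (\<Sum>S \<in> Pow {..<2 * n}. (-1) ^ card S * (-1) ^ min r (card ((\<lambda>k. k div 2) ` S)))"
    unfolding tutte_def
  proof (rule sum.cong)
    fix S assume "S \<in> Pow {..<2 * n}"
    then have S: "S \<subseteq> {..<2 * n}" "finite S" by (auto intro: finite_subset)
    then have "min r (card ((\<lambda>k. k div 2) ` S)) \<le> card S"
      by (simp add: card_image_le min.coboundedI2)
    \<comment> \<open>A difference has the parity of the sum, so the summand splits into
      \<open>(-1) ^ card S\<close> and a function of the classes met, the shape that
      \<open>signed_sum_over_pairs\<close> handles.\<close>
    from neg_one_power_add_eq_neg_one_power_diff[OF this, where 'a = int] S
    show "((2::int) - 1) ^ (mrank (thick_uniform n r) (ground (thick_uniform n r))
          - mrank (thick_uniform n r) S)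
        * (0 - 1) ^ (card S - mrank (thick_uniform n r) S) =
        (-1) ^ card S * (-1) ^ min r (card ((\<lambda>k. k div 2) ` S))"
      by (simp add: mrank_thick_uniform power_add)
  qed simp
  also have "\<dots> = (\<Sum>A \<in> Pow {..<n}. (-1) ^ card A * (-1) ^ min r (card A))"
    by (rule signed_sum_over_pairs)
  finally have "\<bar>tutte (thick_uniform n r) (2::int) 0\<bar> \<le>
      (\<Sum>A \<in> Pow {..<n}. \<bar>(-1) ^ card A * (-1) ^ min r (card A)\<bar>)"
    by simp
  also have "\<dots> = 2 ^ n" by (simp add: abs_mult power_abs card_Pow)
  finally show ?thesis .
qed

text \<open>A basis is coded by the set \<open>A\<close> of classes that it meets and the set \<open>B \<subseteq> A\<close> of classes where it
  takes the odd element.\<close>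

lemma tutte_thick_uniform_1_1_ge:
  assumes "r \<le> n"
  shows "int (2 ^ r * (n choose r)) \<le> tutte (thick_uniform n r) 1 1"
proof -
  define P where "P = (SIGMA A : {A. A \<subseteq> {..<n} \<and> card A = r}. Pow A)"
  define c :: "nat set \<times> nat set \<Rightarrow> nat set"
    where "c = (\<lambda>(A, B). (\<lambda>i. if i \<in> B then 2 * i + 1 else 2 * i) ` A)"
  have c_div: "(\<lambda>k. k div 2) ` c (A, B) = A" for A B
  proof -
    have "(if i \<in> B then 2 * i + 1 else 2 * i) div 2 = i" for i by simp
    then show ?thesis by (simp only: c_def image_image prod.case image_ident)
  qed
  \<comment> \<open>Elements of \<open>B\<close> outside \<open>A\<close> would leave no trace in
    the code, hence the condition \<open>B \<subseteq> A\<close>.\<close>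
  have c_odd: "{i. 2 * i + 1 \<in> c (A, B)} = B" if "B \<subseteq> A" for A B
  proof -
    have "2 * i + 1 \<noteq> 2 * j" for i j :: nat by presburger
    with that show ?thesis by (auto simp: c_def split: if_splits)
  qed
  have "inj_on c P"
  proof (rule inj_onI, clarify)
    fix A B A' B' assume "(A, B) \<in> P" "(A', B') \<in> P" and eq: "c (A, B) = c (A', B')"
    then have "B \<subseteq> A" "B' \<subseteq> A'" by (auto simp: P_def)
    with eq show "A = A' \<and> B = B'" by (metis c_div c_odd)
  qed
  then have "card (c ` P) = card P" by (rule card_image)
  also have "\<dots> = (\<Sum>A \<in> {A. A \<subseteq> {..<n} \<and> card A = r}. card (Pow A))"
    unfolding P_def by (rule card_SigmaI) (auto intro: finite_subset)
  also have "\<dots> = (\<Sum>A \<in> {A. A \<subseteq> {..<n} \<and> card A = r}. 2 ^ r)"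
    by (rule sum.cong) (auto simp: card_Pow finite_subset)
  also have "\<dots> = 2 ^ r * (n choose r)" using n_subsets[of "{..<n}" r] by simp
  finally have card: "card (c ` P) = 2 ^ r * (n choose r)" .
  let ?t = "\<lambda>S. ((1::int) - 1) ^ (mrank (thick_uniform n r) (ground (thick_uniform n r))
          - mrank (thick_uniform n r) S)
        * (1 - 1) ^ (card S - mrank (thick_uniform n r) S)"
  have sub: "c ` P \<subseteq> Pow {..<2 * n}"
    by (force simp: c_def P_def)
  \<comment> \<open>Coded sets have size and rank \<open>r\<close>, so both exponents vanish and
    \<open>0 ^ 0 = 1\<close> applies.\<close>
  have one: "?t S = 1" if S: "S \<in> c ` P" for S
  proof -
    from S obtain A B where A: "A \<subseteq> {..<n}" "card A = r" "S = c (A, B)"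
      by (auto simp: P_def)
    have "card S = card A"
      unfolding A(3) c_def prod.case
      by (intro card_image inj_on_inverseI[where g = "\<lambda>k. k div 2"]) simp
    then have "card S = r" by (simp add: A)
    moreover have "S \<subseteq> {..<2 * n}" using S sub by blast
    moreover have "card ((\<lambda>k. k div 2) ` S) = r" using A c_div by metis
    ultimately show ?thesis
      using assms by (simp add: mrank_thick_uniform image_div_2_lessThan)
  qed
  have "int (2 ^ r * (n choose r)) = (\<Sum>S \<in> c ` P. ?t S)"
    using one card by simp
  \<comment> \<open>The remaining summands are nonnegative, so it need not be shown that every basis
    is coded.\<close>
  also have "\<dots> \<le> (\<Sum>S \<in> Pow {..<2 * n}. ?t S)"
    using sub by (intro sum_mono2) auto
  finally show ?thesis by (simp add: tutte_def)
qed

section \<open>Growth of the binomial coefficients\<close>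

text \<open>This is the ratio of consecutive coefficients with denominators cleared; the factor
  \<open>3\<close> is the quotient of \<open>3 * m + 3\<close> by \<open>m + 1\<close>.\<close>

lemma binomial_3m_Suc:
  "(3 * Suc m choose Suc m) * ((2 * m + 2) * (2 * m + 1)) =
   3 * ((3 * m + 2) * (3 * m + 1)) * (3 * m choose m)"
proof -
  let ?F = "fact m * fact (2 * m) :: nat"
  have F: "?F * (3 * m choose m) = fact (3 * m)"
    using binomial_fact_lemma[of m "3 * m"] by simp
  have eqs: "3 * Suc m = Suc (Suc (Suc (3 * m)))"
    "Suc (Suc (Suc (3 * m))) - Suc m = Suc (Suc (2 * m))" by simp_all
  have G: "fact (Suc m) * fact (Suc (Suc (2 * m))) * (3 * Suc m choose Suc m) =
      fact (Suc (Suc (Suc (3 * m))))"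
    using binomial_fact_lemma[of "Suc m" "3 * Suc m"] unfolding eqs by linarith
  have "(Suc m * ?F) * ((3 * Suc m choose Suc m) * ((2 * m + 2) * (2 * m + 1))) =
      fact (Suc m) * fact (Suc (Suc (2 * m))) * (3 * Suc m choose Suc m)"
    by (simp only: fact_Suc of_nat_id) (simp only: ac_simps Suc_eq_plus1 numeral_2_eq_2 add_Suc_right add_0_right)
  also have "\<dots> = (3 * m + 3) * (3 * m + 2) * (3 * m + 1) * fact (3 * m)"
    unfolding G by (simp only: fact_Suc of_nat_id) (simp add: algebra_simps)
  also have "\<dots> = (Suc m * ?F) * (3 * ((3 * m + 2) * (3 * m + 1)) * (3 * m choose m))"
    unfolding F[symmetric] by (simp add: algebra_simps)
  finally show ?thesis by simp
qed

text \<open>The ratio tends to \<open>27/4\<close>. The bound \<open>6\<close> is enough because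
  \<open>6 * 6 = 36\<close> exceeds \<open>32\<close>; it holds from \<open>m = 4\<close> on and
  just fails at \<open>m = 3\<close>.\<close>

lemma binomial_3m_step:
  assumes "m \<ge> 4"
  shows "6 * (3 * m choose m) \<le> (3 * Suc m choose Suc m)"
proof -
  have "4 * m \<le> m * m" using assms by (rule mult_right_mono) simp
  with assms have "9 * m + 6 \<le> 3 * (m * m)" by linarith
  then have le: "6 * ((2 * m + 2) * (2 * m + 1)) \<le> 3 * ((3 * m + 2) * (3 * m + 1))"
    by (simp add: algebra_simps)
  have "(6 * (3 * m choose m)) * ((2 * m + 2) * (2 * m + 1)) \<le>
      3 * ((3 * m + 2) * (3 * m + 1)) * (3 * m choose m)"
    using mult_right_mono[OF le, of "3 * m choose m"] by (simp only: ac_simps)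
  also have "\<dots> = (3 * Suc m choose Suc m) * ((2 * m + 2) * (2 * m + 1))"
    by (rule binomial_3m_Suc[symmetric])
  finally show ?thesis by (rule mult_right_le_imp_le) simp
qed

text \<open>Iterates the step from \<open>12 choose 4 = 495\<close>, with \<open>6 ^ 4\<close> moved
  across to avoid division.\<close>

lemma binomial_3m_ge:
  assumes "m \<ge> 4"
  shows "495 * 6 ^ m \<le> 6 ^ 4 * (3 * m choose m)"
  using assms
proof (induction m rule: dec_induct)
  case base
  have "(12 choose 4) = (495::nat)" by (simp add: numeral_eq_Suc)
  then show ?case by simp
next
  case (step m)
  then show ?case using binomial_3m_step[of m] by simp
qed

lemma power_less_binomial_3m_square:
  assumes "m \<ge> 17"
  shows "32 ^ m < (3 * m choose m)\<^sup>2"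
proof -
  \<comment> \<open>The least \<open>m\<close> for which \<open>(36/32) ^ m\<close> exceeds the
    square of \<open>6 ^ 4 / 495\<close>, about \<open>6.85\<close>, is \<open>17\<close>;
    afterwards the right side grows faster.\<close>
  have growth: "(6 ^ 4)\<^sup>2 * 32 ^ m < (495)\<^sup>2 * (36::nat) ^ m"
    using assms by (induction m rule: dec_induct) simp_all
  also have "\<dots> = (495 * 6 ^ m)\<^sup>2"
    by (simp add: power_mult_distrib flip: power_mult) (simp add: power_mult mult.commute[of m])
  also have "\<dots> \<le> (6 ^ 4 * (3 * m choose m))\<^sup>2"
    using assms by (intro power_mono binomial_3m_ge) auto
  also have "\<dots> = (6 ^ 4)\<^sup>2 * (3 * m choose m)\<^sup>2" by (rule power_mult_distrib)
  finally show ?thesis by (simp only: mult_less_cancel1)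
qed

section \<open>The inequality for the doubled uniform matroids and the infinite family\<close>

lemma tutte_thick_uniform_less:
  assumes "m \<ge> 17"
  defines "M \<equiv> thick_uniform (3 * m) (2 * m)"
  shows "tutte M (2::int) 0 * tutte M 0 2 < (tutte M 1 1)\<^sup>2"
proof -
  have "tutte M (2::int) 0 * tutte M 0 2 \<le> \<bar>tutte M (2::int) 0\<bar> * \<bar>tutte M (0::int) 2\<bar>"
    by (metis abs_ge_self abs_mult)
  also have "\<dots> \<le> 2 ^ (3 * m) * 2 ^ (2 * (3 * m))"
    using tutte_thick_uniform_2_0_le[of "3 * m" "2 * m"] tutte_0_2_le[of M]
    by (intro mult_mono) (auto simp: M_def)
  \<comment> \<open>The factor \<open>16 ^ m\<close> of \<open>8 ^ (3 * m)\<close> is split off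
    because it is the square of \<open>2 ^ (2 * m)\<close>, the number of bases over each choice of
    classes.\<close>
  also have "\<dots> = int (16 ^ m * 32 ^ m)"
    by (simp add: power_mult flip: power_mult_distrib)
  also have "\<dots> < int (16 ^ m * (3 * m choose m)\<^sup>2)"
    using power_less_binomial_3m_square[OF assms(1)] by (simp only: of_nat_less_iff) simp
  also have "\<dots> = (int (2 ^ (2 * m) * (3 * m choose (2 * m))))\<^sup>2"
  proof -
    have "(16::int) ^ m = 2 ^ (2 * m * 2)" by (simp add: power_mult mult.commute[of _ 2])
    also have "\<dots> = (2 ^ (2 * m))\<^sup>2" by (rule power_mult)
    finally show ?thesis
      using binomial_symmetric[of m "3 * m"] by (simp add: power_mult_distrib)
  qed
  also have "\<dots> \<le> (tutte M 1 1)\<^sup>2"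
    unfolding M_def by (intro power_mono tutte_thick_uniform_1_1_ge) auto
  finally show ?thesis .
qed

theorem theorem1p1:
  "infinite ({M :: nat matroid.
      matroid M \<and>
      (\<forall>e. \<not> is_loop M e) \<and>
      (\<forall>e. \<not> is_coloop M e) \<and>
      tutte M (2::int) 0 * tutte M 0 2 < (tutte M 1 1)\<^sup>2} // matroid_iso)"
  (is "infinite (?C // _)")
proof
  let ?M = "\<lambda>m. thick_uniform (3 * m) (2 * m)"
  let ?q = "\<lambda>m. matroid_iso `` {?M m}"
  have mat: "matroid (?M m)" for m
    by (simp add: thick_uniform_def matroid_truncated_partition)
  have "?M m \<in> ?C" if m: "m \<ge> 17" for m
  proof -
    have "\<not> is_loop (?M m) e" "\<not> is_coloop (?M m) e" for e
      unfolding thick_uniform_def using m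
      by (intro no_loop_truncated_partition no_coloop_truncated_partition;
          simp only: image_div_2_lessThan card_lessThan; simp)+
    with mat tutte_thick_uniform_less[OF m] show ?thesis by blast
  qed
  then have sub: "?q ` {17..} \<subseteq> ?C // matroid_iso"
    by (auto intro!: quotientI)
  \<comment> \<open>The ground set has \<open>6 * m\<close> elements and isomorphisms preserve its
    size, so distinct \<open>m\<close> give distinct classes.\<close>
  have "inj_on ?q {17..}"
  proof (rule inj_onI)
    fix m k assume "?q m = ?q k"
    then have "(?M m, ?M k) \<in> matroid_iso"
      by (rule eq_equiv_class[OF _ equiv_matroid_iso]) (simp add: mat)
    from card_ground_eq_of_iso[OF this] show "m = k" by simp
  qed
  moreover assume "finite (?C // matroid_iso)"
  with sub have "finite (?q ` {17..})" by (rule finite_subset)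
  ultimately have "finite {17::nat..}" by (simp add: finite_image_iff)
  then show False by (simp add: infinite_Ici)
qed

end
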